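(* Let $D=(d_1,\dots,d_n)$ ($n\ge 1$) be the reduced degree sequence of some caterpillar, and let $\mathbb{C}_D$ be the set of all caterpillars with reduced degree sequence $D$. Then for every real $x>0$ and every $H\in\mathbb{C}_D$, $$M(\mathcal{S}(D),x)\le M(H,x).$$
   Context: All graphs are finite and simple. For a graph $G$, $m(G,k)$ is the number of matchings of $G$ with exactly $k$ edges ($m(G,0)=1$), and $M(G,x)=\sum_{k\ge0}m(G,k)x^k$. A caterpillar is a tree such that deleting all its leaves (degree-1 vertices) leaves a path, called the spine. The reduced degree sequence of a tree is the non-increasing sequence of the degrees of its non-leaf vertices (the degree sequence with all $1$'s removed). Definition of $\mathcal{S}(D)$: for $D=(d_1,\dots,d_n)$ with $d_1\ge\dots\ge d_n\ge2$, let $k=\lceil n/2\rceil$ and define $e_1,\dots,e_n$ by: for $1\le j\le k$, $e_j=d_j$ if $j$ is odd and $e_j=d_{n+2-j}$ if $j$ is even; for $k<j\le n$, $e_j=d_{n+2-j}$ if $n+1-j$ is odd and $e_j=d_j$ if $n+1-j$ is even. If $n=1$, $\mathcal{S}(D)$ is the star $K_{1,d_1}$. If $n\ge2$, $\mathcal{S}(D)$ is the caterpillar obtained from a path $v_1v_2\cdots v_n$ by attaching leaves so that $\deg(v_j)=e_j$ for all $j$ (i.e. $e_1-1$ and $e_n-1$ leaves at the ends, $e_j-2$ leaves at internal $v_j$). (For example, for $n\ge 5$ the spine degrees read $d_1,d_n,d_3,d_{n-2},\dots$ from the left end and $d_2,d_{n-1},d_4,d_{n-3},\dots$ from the right end.)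 *)

theory Defs
  imports Complex_Main "HOL-Library.Multiset"
begin

type_synonym 'a graph = "'a set \<times> 'a set set"

abbreviation verts :: "'a graph \<Rightarrow> 'a set" where "verts \<equiv> fst"
abbreviation edges :: "'a graph \<Rightarrow> 'a set set" where "edges \<equiv> snd"

definition simple_graph :: "'a graph \<Rightarrow> bool" where
  "simple_graph G \<longleftrightarrow>
     finite (verts G) \<and> (\<forall>e\<in>edges G. e \<subseteq> verts G \<and> card e = 2)"

definition adj :: "'a graph \<Rightarrow> ('a \<times> 'a) set" where
  "adj G = {(u, v). {u, v} \<in> edges G}"

definition degree :: "'a graph \<Rightarrow> 'a \<Rightarrow> nat" where
  "degree G v = card {e \<in> edges G. v \<in> e}"

definition connected_graph :: "'a graph \<Rightarrow> bool" where
  "connected_graph G \<longleftrightarrow>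
     verts G \<noteq> {} \<and> (\<forall>u\<in>verts G. \<forall>v\<in>verts G. (u, v) \<in> (adj G)\<^sup>*)"

definition is_cycle :: "'a graph \<Rightarrow> 'a list \<Rightarrow> bool" where
  "is_cycle G c \<longleftrightarrow>
     3 \<le> length c \<and> distinct c \<and>
     (\<forall>i<length c. {c ! i, c ! (Suc i mod length c)} \<in> edges G)"

definition tree :: "'a graph \<Rightarrow> bool" where
  "tree G \<longleftrightarrow> simple_graph G \<and> connected_graph G \<and> \<not> (\<exists>c. is_cycle G c)"

definition leaves :: "'a graph \<Rightarrow> 'a set" where
  "leaves G = {v \<in> verts G. degree G v = 1}"

definition delete_verts :: "'a graph \<Rightarrow> 'a set \<Rightarrow> 'a graph" where
  "delete_verts G S = (verts G - S, {e \<in> edges G. e \<inter> S = {}})"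

text \<open>
  The empty graph counts as a path, so that \<open>K\<^sub>2\<close>, which consists of two leaves, is a caterpillar.
\<close>

definition is_path :: "'a graph \<Rightarrow> bool" where
  "is_path G \<longleftrightarrow>
     (\<exists>p. distinct p \<and> verts G = set p \<and>
          edges G = {{p ! i, p ! Suc i} | i. Suc i < length p})"

definition caterpillar :: "'a graph \<Rightarrow> bool" where
  "caterpillar G \<longleftrightarrow> tree G \<and> is_path (delete_verts G (leaves G))"

definition reduced_degree_sequence :: "'a graph \<Rightarrow> nat list" where
  "reduced_degree_sequence G =
     rev (sorted_list_of_multiset
       (image_mset (degree G) (mset_set (verts G - leaves G))))"

definition caterpillars_with :: "nat list \<Rightarrow> 'a graph set" where
  "caterpillars_with D = {H. caterpillar H \<and> reduced_degree_sequence H = D}"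

definition matching :: "'a graph \<Rightarrow> 'a set set \<Rightarrow> bool" where
  "matching G F \<longleftrightarrow> F \<subseteq> edges G \<and> pairwise disjnt F"

definition num_matchings :: "'a graph \<Rightarrow> nat \<Rightarrow> nat" where
  "num_matchings G k = card {F. matching G F \<and> card F = k}"

text \<open>No matching has more than \<open>card (edges G)\<close> edges, so the sum over all \<open>k\<close> stops there.\<close>

definition matching_poly :: "'a graph \<Rightarrow> real \<Rightarrow> real" where
  "matching_poly G x = (\<Sum>k\<le>card (edges G). real (num_matchings G k) * x ^ k)"

text \<open>
  In \<open>spine_degree D j\<close> the index \<open>j\<close> is 1-based, running over \<open>1, \<dots>, length D\<close>; the entry \<open>d\<^sub>i\<close>
  of \<open>D\<close> is the list element \<open>D ! (i - 1)\<close>.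
\<close>

definition spine_degree :: "nat list \<Rightarrow> nat \<Rightarrow> nat" where
  "spine_degree D j =
    (let n = length D; k = (n + 1) div 2; d = (\<lambda>i. D ! (i - 1)) in
     if j \<le> k
     then (if odd j then d j else d (n + 2 - j))
     else (if odd (n + 1 - j) then d (n + 2 - j) else d j))"

definition num_pendants :: "nat list \<Rightarrow> nat \<Rightarrow> nat" where
  "num_pendants D j =
    (if length D = 1 then spine_degree D j
     else if j = 1 \<or> j = length D then spine_degree D j - 1
     else spine_degree D j - 2)"

text \<open>\<open>Pendant j i\<close> is the \<open>i\<close>-th leaf attached to the spine vertex \<open>Spine j\<close>.\<close>

datatype cat_vertex = Spine nat | Pendant nat nat

text \<open>For \<open>length D = 1\<close> this is the star with centre \<open>Spine 1\<close> and \<open>d\<^sub>1\<close> leaves.\<close>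

definition S_caterpillar :: "nat list \<Rightarrow> cat_vertex graph" where
  "S_caterpillar D =
    (let n = length D in
     (Spine ` {1..n} \<union> {Pendant j i | j i. j \<in> {1..n} \<and> i \<in> {1..num_pendants D j}},
      {{Spine j, Spine (j + 1)} | j. 1 \<le> j \<and> j + 1 \<le> n} \<union>
      {{Spine j, Pendant j i} | j i. j \<in> {1..n} \<and> i \<in> {1..num_pendants D j}}))"

end

theory Submission
  imports Defs
begin

text \<open>
  Put \<open>c\<^sub>j = 1 + (e\<^sub>j - 2) x\<close> for a spine with degrees \<open>e\<^sub>1, \<dots>, e\<^sub>n\<close>. Expanding at the spine vertices, the
  matching polynomial is the continuant of \<open>1, c\<^sub>1, \<dots>, c\<^sub>n, 1\<close>, where continuants satisfy
  \<open>K(a, b, \<dots>) = a K(b, \<dots>) + x K(\<dots>)\<close>; the two outer ones account for the spine ends having one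
  spine neighbour less.

  Write the sequence as \<open>A w B\<close>, let \<open>\<alpha>\<close> and \<open>\<beta>\<close> be the values of the continued fractions read off
  from \<open>A\<close> and \<open>B\<close> outwards from \<open>w\<close>, and let \<open>\<omega>\<close> and \<open>\<omega>'\<close> be those of \<open>w\<close> and its reverse. Reversing
  \<open>w\<close> does not increase the continuant if \<open>\<alpha> - \<beta>\<close> and \<open>\<omega> - \<omega>'\<close> have the same sign. Distinct degrees
  give entries that differ by at least \<open>x\<close>, so such continued fractions compare alternately
  lexicographically. Hence, starting from any arrangement, reversals move the two largest
  degrees to the left and right end, then the two smallest ones next to them, then the next two
  largest ones, and so on inwards, without ever increasing the continuant. The result is the
  spine of \<open>\<S>(D)\<close>.
\<close>

section \<open>Continuants and reversal of a segment\<close>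

text \<open>The product of the matrices ((c, x), (1, 0)) over the list, applied to the column v. For
  v = (1, 0) the first component is the continuant of the list and the second one that of its
  tail.\<close>

fun transfer :: "real \<Rightarrow> real list \<Rightarrow> real \<times> real \<Rightarrow> real \<times> real" where
  "transfer x [] v = v"
| "transfer x (c # cs) v = (c * fst (transfer x cs v) + x * snd (transfer x cs v), fst (transfer x cs v))"

text \<open>Euler's rule for splitting a continuant: u comes from the part left of the cut, v from
  the part right of it, and the second product belongs to the link across the cut.\<close>

definition pairing :: "real \<Rightarrow> real \<times> real \<Rightarrow> real \<times> real \<Rightarrow> real" where
  "pairing x u v = fst u * fst v + x * (snd u * snd v)"

lemma transfer_append: "transfer x (as @ bs) v = transfer x as (transfer x bs v)"
  by (induction as) auto

lemma pairing_commute: "pairing x u v = pairing x v u"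
  by (simp add: pairing_def mult.commute)

text \<open>Each matrix ((c, x), (1, 0)) is self-adjoint for \<open>pairing\<close>, so a product of
  them changes sides in the opposite order.\<close>

lemma pairing_transfer: "pairing x u (transfer x w v) = pairing x (transfer x (rev w) u) v"
proof (induction w arbitrary: u)
  case (Cons c w)
  have "pairing x u (transfer x (c # w) v) = pairing x (transfer x [c] u) (transfer x w v)"
    by (simp add: pairing_def algebra_simps)
  then show ?case
    by (simp add: Cons.IH transfer_append)
qed simp

lemma transfer_linear:
  "fst (transfer x w v) = fst v * fst (transfer x w (1, 0)) + snd v * fst (transfer x w (0, 1))"
  "snd (transfer x w v) = fst v * snd (transfer x w (1, 0)) + snd v * snd (transfer x w (0, 1))"
  by (induction w) (auto simp: algebra_simps)

text \<open>By \<open>pairing_transfer\<close>, reversing \<open>w\<close> transposes the form. The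
  antisymmetric part of a form in two dimensions is a multiple of the determinant of u and v; the
  other factor compares the off-diagonal entries of the matrix of \<open>w\<close>, the lower one
  weighted by x.\<close>

lemma pairing_reverse_diff:
  "pairing x u (transfer x w v) - pairing x u (transfer x (rev w) v) =
   (fst u * snd v - snd u * fst v) * (fst (transfer x w (0, 1)) - x * snd (transfer x w (1, 0)))"
proof -
  have "pairing x u (transfer x (rev w) v) = pairing x v (transfer x w u)"
    by (metis pairing_commute pairing_transfer)
  then show ?thesis
    unfolding pairing_def
    by (simp add: transfer_linear[of x w u] transfer_linear[of x w v] algebra_simps)
qed

lemma transfer_bounds:
  assumes "x > 0" "\<And>c. c \<in> set w \<Longrightarrow> c \<ge> 1" "0 \<le> snd v" "snd v \<le> fst v"
  shows "0 \<le> snd (transfer x w v) \<and> snd (transfer x w v) \<le> fst (transfer x w v)"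
  using assms(2)
proof (induction w)
  case (Cons c w)
  let ?p = "fst (transfer x w v)" and ?q = "snd (transfer x w v)"
  have q: "0 \<le> ?q" "?q \<le> ?p"
    using Cons by auto
  have "1 * ?p \<le> c * ?p"
    using Cons.prems q by (intro mult_right_mono) auto
  moreover have "0 \<le> x * ?q"
    using q \<open>x > 0\<close> by simp
  ultimately show ?case
    using q by simp
qed (use assms in auto)

lemma transfer_fst_pos:
  assumes "x > 0" "\<And>c. c \<in> set w \<Longrightarrow> c \<ge> 1" "0 \<le> snd v" "snd v \<le> fst v" "0 < fst v"
  shows "0 < fst (transfer x w v)"
  using assms(2)
proof (induction w)
  case (Cons c w)
  have "0 < c * fst (transfer x w v)"
    using Cons by (intro mult_pos_pos) (auto simp: order_less_le_trans[OF zero_less_one])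
  moreover have "0 \<le> x * snd (transfer x w v)"
    using transfer_bounds[of x w v] Cons.prems assms by simp
  ultimately show ?case
    by simp
qed (use assms in auto)

text \<open>The start vector (0, 1) violates \<open>snd v \<le> fst v\<close>, which puts it outside
  \<open>transfer_bounds\<close>.\<close>

lemma transfer_nonneg:
  assumes "x > 0" "\<And>c. c \<in> set w \<Longrightarrow> c \<ge> 1"
  shows "0 \<le> fst (transfer x w (0, 1)) \<and> 0 \<le> snd (transfer x w (0, 1))"
  using assms(2)
proof (induction w)
  case (Cons c w)
  then have "0 \<le> c"
    by (meson dual_order.trans list.set_intros(1) zero_le_one)
  then show ?case
    using Cons assms(1) by simp
qed simp

text \<open>With k, l, k' from the matrix of m, the off-diagonal entries in
  \<open>pairing_reverse_diff\<close> are x (a k + x l) and, after weighting, x (b k + k'). As l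
  \<le> k, the gap between a and b absorbs x l, so their difference is not positive. In terms of
  quotients: the larger end entry belongs beside the smaller continued fraction.\<close>

lemma pairing_reverse_le:
  assumes x: "x > 0" and m: "\<And>c. c \<in> set m \<Longrightarrow> c \<ge> 1" and ab: "a + x \<le> b"
  shows "fst u * snd v \<le> snd u * fst v \<Longrightarrow>
      pairing x u (transfer x (rev (a # m @ [b])) v) \<le> pairing x u (transfer x (a # m @ [b]) v)"
    and "snd u * fst v \<le> fst u * snd v \<Longrightarrow>
      pairing x u (transfer x (a # m @ [b]) v) \<le> pairing x u (transfer x (rev (a # m @ [b])) v)"
proof -
  let ?w = "a # m @ [b]"
  define k l where "k = fst (transfer x m (1, 0))" and "l = snd (transfer x m (1, 0))"
  define k' where "k' = fst (transfer x m (0, 1))"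
  have "0 \<le> l" "l \<le> k"
    using transfer_bounds[of x m "(1, 0)"] x m by (auto simp: k_def l_def)
  have "0 \<le> k'"
    using transfer_nonneg x m by (auto simp: k'_def)
  have e2: "fst (transfer x ?w (0, 1)) = x * (a * k + x * l)"
    by (simp add: transfer_append transfer_linear[of x m "(x, 0)"] k_def l_def algebra_simps)
  have e1: "snd (transfer x ?w (1, 0)) = b * k + k'"
    by (simp add: transfer_append transfer_linear[of x m "(b, 1)"] k_def k'_def)
  have "a * k + x * l \<le> a * k + x * k"
    using x \<open>l \<le> k\<close> by simp
  also have "\<dots> = (a + x) * k"
    by (simp add: algebra_simps)
  also have "\<dots> \<le> b * k"
    using ab \<open>0 \<le> l\<close> \<open>l \<le> k\<close> by (intro mult_right_mono) auto
  finally have "fst (transfer x ?w (0, 1)) - x * snd (transfer x ?w (1, 0)) \<le> 0"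
    unfolding e1 e2 using x \<open>0 \<le> k'\<close> by (simp add: mult_left_mono)
  then show "fst u * snd v \<le> snd u * fst v \<Longrightarrow>
      pairing x u (transfer x (rev ?w) v) \<le> pairing x u (transfer x ?w v)"
    and "snd u * fst v \<le> fst u * snd v \<Longrightarrow>
      pairing x u (transfer x ?w v) \<le> pairing x u (transfer x (rev ?w) v)"
    using pairing_reverse_diff[of x u ?w v]
      mult_nonpos_nonpos[of "fst u * snd v - snd u * fst v"
        "fst (transfer x ?w (0, 1)) - x * snd (transfer x ?w (1, 0))"]
      mult_nonneg_nonpos[of "fst u * snd v - snd u * fst v"
        "fst (transfer x ?w (0, 1)) - x * snd (transfer x ?w (1, 0))"]
    by linarith+
qed

section \<open>Extremal arrangement of the degrees\<close>

definition weight :: "real \<Rightarrow> nat \<Rightarrow> real" where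
  "weight x d = 1 + (real d - 2) * x"

text \<open>
  The start vector \<open>(1, 1)\<close> stands for the entry \<open>1\<close> beyond the end of the spine. A quotient of the
  two components of \<open>tail_pair x A\<close> is a continued fraction, and \<open>cf_le\<close> compares two of these by
  cross multiplication. In \<open>join_value x A B\<close> the list \<open>A\<close> is read from the middle to the left, so the
  spine is \<open>rev A @ B\<close>.
\<close>

definition tail_pair :: "real \<Rightarrow> nat list \<Rightarrow> real \<times> real" where
  "tail_pair x ds = transfer x (map (weight x) ds) (1, 1)"

definition join_value :: "real \<Rightarrow> nat list \<Rightarrow> nat list \<Rightarrow> real" where
  "join_value x A B = pairing x (tail_pair x A) (tail_pair x B)"

definition cf_le :: "real \<Rightarrow> nat list \<Rightarrow> nat list \<Rightarrow> bool" where
  "cf_le x A B \<longleftrightarrow>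
     fst (tail_pair x A) * snd (tail_pair x B) \<le> snd (tail_pair x A) * fst (tail_pair x B)"

section \<open>Comparing continued fractions\<close>

lemma weight_ge_1: "x > 0 \<Longrightarrow> d \<ge> 2 \<Longrightarrow> weight x d \<ge> 1"
  by (simp add: weight_def)

lemma weight_gap:
  assumes "x > 0" "d < e"
  shows "weight x d + x \<le> weight x e"
proof -
  have "(real d + 1) * x \<le> real e * x"
    using assms by (intro mult_right_mono) auto
  then show ?thesis
    by (simp add: weight_def algebra_simps)
qed

lemma tail_pair_Cons:
  "tail_pair x (d # A) = (weight x d * fst (tail_pair x A) + x * snd (tail_pair x A), fst (tail_pair x A))"
  by (simp add: tail_pair_def)

lemma tail_pair_bounds:
  assumes "x > 0" "\<And>d. d \<in> set A \<Longrightarrow> d \<ge> 2"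
  shows "0 \<le> snd (tail_pair x A)" "snd (tail_pair x A) \<le> fst (tail_pair x A)"
    "0 < fst (tail_pair x A)"
  unfolding tail_pair_def
  using transfer_bounds[of x "map (weight x) A" "(1, 1)"]
    transfer_fst_pos[of x "map (weight x) A" "(1, 1)"] assms weight_ge_1 by auto

lemma join_value_commute: "join_value x A B = join_value x B A"
  by (simp add: join_value_def pairing_commute)

lemma join_value_shift: "join_value x A (w @ B) = join_value x (rev w @ A) B"
  by (simp add: join_value_def tail_pair_def transfer_append pairing_transfer rev_map)

text \<open>The start vector (1, 1) has quotient 1, the least possible one, because the second
  component never exceeds the first.\<close>

lemma cf_le_Nil: "x > 0 \<Longrightarrow> (\<And>d. d \<in> set A \<Longrightarrow> d \<ge> 2) \<Longrightarrow> cf_le x [] A"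
  using tail_pair_bounds[of x A] by (simp add: cf_le_def) (simp add: tail_pair_def)

text \<open>If A has quotient q, then \<open>d # A\<close> has quotient \<open>weight x d\<close> +
  x / q, which decreases in q.\<close>

lemma cf_le_Cons_same:
  assumes "x > 0" "cf_le x B A"
  shows "cf_le x (d # A) (d # B)"
proof -
  have "x * (fst (tail_pair x B) * snd (tail_pair x A)) \<le>
     x * (snd (tail_pair x B) * fst (tail_pair x A))"
    using assms by (simp add: cf_le_def)
  then show ?thesis
    by (simp add: cf_le_def tail_pair_Cons algebra_simps)
qed

text \<open>Quotients are at least 1, so the tail A adds at most x to its first entry. The gap
  between the weights of d and e makes up for that.\<close>

lemma cf_le_Cons_less:
  assumes x: "x > 0" and "d < e"
    and A: "\<And>d. d \<in> set A \<Longrightarrow> d \<ge> 2" and B: "\<And>d. d \<in> set B \<Longrightarrow> d \<ge> 2"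
  shows "cf_le x (d # A) (e # B)"
proof -
  let ?p = "fst (tail_pair x A)" and ?q = "snd (tail_pair x A)"
  let ?r = "fst (tail_pair x B)" and ?s = "snd (tail_pair x B)"
  have "weight x d * ?p + x * ?q \<le> (weight x d + x) * ?p"
    using tail_pair_bounds[OF x, of A] A x by (simp add: algebra_simps)
  also have "\<dots> \<le> weight x e * ?p"
    using tail_pair_bounds[OF x, of A] A weight_gap[OF x \<open>d < e\<close>] by (intro mult_right_mono) auto
  finally have "(weight x d * ?p + x * ?q) * ?r \<le> weight x e * ?p * ?r"
    using tail_pair_bounds[OF x, of B] B by (intro mult_right_mono) auto
  moreover have "0 \<le> x * (?p * ?s)"
    using tail_pair_bounds[OF x, of A] tail_pair_bounds[OF x, of B] A B x by simp
  ultimately show ?thesis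
    by (simp add: cf_le_def tail_pair_Cons algebra_simps)
qed

text \<open>
  The flag \<open>m\<close> says whether maximal (\<open>True\<close>) or minimal (\<open>False\<close>) degrees are to be placed next;
  it reverses all comparisons.
\<close>

definition cf_before :: "real \<Rightarrow> bool \<Rightarrow> nat list \<Rightarrow> nat list \<Rightarrow> bool" where
  "cf_before x m A B \<longleftrightarrow> (if m then cf_le x A B else cf_le x B A)"

definition dominated :: "bool \<Rightarrow> nat \<Rightarrow> nat \<Rightarrow> bool" where
  "dominated m d r \<longleftrightarrow> (if m then d \<le> r else r \<le> d)"

text \<open>Different first entries decide the comparison; equal ones invert that of the tails. Both
  outcomes agree with the flipped flag.\<close>

lemma cf_before_Cons:
  assumes "x > 0" and "dominated m d r" and "d = r \<Longrightarrow> cf_before x m A B"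
    and "\<And>d. d \<in> set A \<Longrightarrow> d \<ge> 2" and "\<And>d. d \<in> set B \<Longrightarrow> d \<ge> 2"
  shows "cf_before x (\<not> m) (r # A) (d # B)"
proof (cases "d = r")
  case True
  with assms show ?thesis
    by (auto simp: cf_before_def intro: cf_le_Cons_same)
next
  case False
  then have "if m then d < r else r < d"
    using assms(2) by (auto simp: dominated_def split: if_splits)
  with assms show ?thesis
    by (auto simp: cf_before_def intro: cf_le_Cons_less split: if_splits)
qed

text \<open>If \<open>w\<close> starts with some f \<noteq> r, reverse its initial segment ending at
  an occurrence of r. The hypothesis \<open>before\<close> ranges over all s because what follows r
  in \<open>w\<close> is not known in advance.\<close>

lemma place_extremal_left:
  assumes x: "x > 0" and r: "r \<in> set w" and dom: "\<And>d. d \<in> set w \<Longrightarrow> dominated m d r"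
    and ge2: "\<And>d. d \<in> set w \<Longrightarrow> d \<ge> 2"
    and before: "\<And>s. set s \<subseteq> set w \<Longrightarrow> cf_before x m A (s @ B)"
  shows "\<exists>w'. mset w = mset (r # w') \<and> join_value x A (r # w' @ B) \<le> join_value x A (w @ B)"
proof -
  obtain u v where w: "w = u @ r # v"
    using r by (meson split_list)
  show ?thesis
  proof (cases u)
    case Nil
    then show ?thesis using w by (intro exI[of _ v]) simp
  next
    case (Cons f u')
    show ?thesis
    proof (cases "f = r")
      case True
      then show ?thesis using w Cons by (intro exI[of _ "u' @ r # v"]) simp
    next
      case False
      let ?m = "map (weight x) u'" and ?a = "weight x f" and ?b = "weight x r"
      let ?U = "tail_pair x A" and ?V = "tail_pair x (v @ B)"
      have m1: "c \<ge> 1" if "c \<in> set ?m" for c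
        using that w Cons ge2 weight_ge_1[OF x] by auto
      have m2: "c \<ge> 1" if "c \<in> set (rev ?m)" for c
        using that m1 by auto
      have cf: "cf_before x m A (v @ B)"
        using before[of v] w by auto
      have "pairing x ?U (transfer x (rev (?a # ?m @ [?b])) ?V)
          \<le> pairing x ?U (transfer x (?a # ?m @ [?b]) ?V)"
      proof (cases m)
        case True
        then have "f < r"
          using dom[of f] \<open>f \<noteq> r\<close> w Cons by (auto simp: dominated_def)
        then show ?thesis
          using pairing_reverse_le(1)[OF x m1 weight_gap[OF x]] cf True
          by (simp only: cf_before_def cf_le_def if_True)
      next
        case False
        then have "r < f"
          using dom[of f] \<open>f \<noteq> r\<close> w Cons by (auto simp: dominated_def)
        have "snd ?U * fst ?V \<le> fst ?U * snd ?V"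
          using cf False by (simp add: cf_before_def cf_le_def mult.commute)
        \<comment> \<open>Roles are exchanged: the already reversed segment, which starts with the
          smaller entry, is the \<open>a # m @ [b]\<close> of the second inequality.\<close>
        then show ?thesis
          using pairing_reverse_le(2)[of x "rev ?m" ?b ?a ?U ?V] x m2 weight_gap[OF x \<open>r < f\<close>]
          by simp
      qed
      then have "join_value x A (r # (rev u' @ f # v) @ B) \<le> join_value x A (w @ B)"
        unfolding join_value_def w Cons tail_pair_def
        by (simp add: transfer_append rev_map)
      then show ?thesis
        using w Cons by (intro exI[of _ "rev u' @ f # v"]) simp
    qed
  qed
qed

text \<open>Mirror image of \<open>place_extremal_left\<close>: the join value is symmetric, and
  seen from B the list \<open>w\<close> is reversed.\<close>

lemma place_extremal_right:
  assumes x: "x > 0" and r: "r \<in> set w" and dom: "\<And>d. d \<in> set w \<Longrightarrow> dominated m d r"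
    and ge2: "\<And>d. d \<in> set w \<Longrightarrow> d \<ge> 2"
    and before: "\<And>s. set s \<subseteq> set w \<Longrightarrow> cf_before x m B (s @ A)"
  shows "\<exists>w'. mset w = mset (r # w') \<and> join_value x A (w' @ r # B) \<le> join_value x A (w @ B)"
proof -
  obtain w' where w': "mset (rev w) = mset (r # w')"
      "join_value x B (r # w' @ A) \<le> join_value x B (rev w @ A)"
    using place_extremal_left[OF x, of r "rev w" m B A] assms by auto
  have "join_value x B (r # w' @ A) = join_value x A (rev w' @ r # B)"
    using join_value_shift[of x B "r # w'" A] by (simp add: join_value_commute)
  moreover have "join_value x B (rev w @ A) = join_value x A (w @ B)"
    using join_value_shift[of x B "rev w" A] by (simp add: join_value_commute)
  ultimately show ?thesis
    using w' by (intro exI[of _ "rev w'"]) simp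
qed

text \<open>
  The invariant of the placement. The second part excludes \<open>s = []\<close> because the left-hand side is
  served first: \<open>B\<close> is only compared with what follows an entry already placed on \<open>A\<close>.
\<close>

definition ready :: "real \<Rightarrow> bool \<Rightarrow> nat list \<Rightarrow> nat list \<Rightarrow> nat set \<Rightarrow> bool" where
  "ready x m A B R \<longleftrightarrow>
     (\<forall>s. set s \<subseteq> R \<longrightarrow> cf_before x m A (s @ B)) \<and>
     (\<forall>s. set s \<subseteq> R \<longrightarrow> s \<noteq> [] \<longrightarrow> cf_before x m B (s @ A))"

text \<open>By \<open>cf_before_Cons\<close> each new comparison reduces to one of the tails, in
  which r or r' counts as one more unplaced degree. Hence the old invariant is used with s' @ [r']
  and s' @ [r].\<close>

lemma ready_step:
  assumes x: "x > 0" and rdy: "ready x m A B R" and R: "insert r (insert r' R') \<subseteq> R"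
    and dom: "\<And>d. d \<in> insert r' R' \<Longrightarrow> dominated m d r" "\<And>d. d \<in> R' \<Longrightarrow> dominated m d r'"
    and ge2: "\<And>d. d \<in> set A \<union> set B \<union> R \<Longrightarrow> d \<ge> 2"
  shows "ready x (\<not> m) (r # A) (r' # B) R'"
  unfolding ready_def
proof (intro conjI allI impI)
  fix s assume s: "set s \<subseteq> R'"
  show "cf_before x (\<not> m) (r # A) (s @ r' # B)"
  proof (cases s)
    case Nil
    have "cf_before x m A ([] @ B)"
      using rdy unfolding ready_def by (metis empty_set empty_subsetI)
    then show ?thesis
      using Nil x dom ge2 by (auto intro!: cf_before_Cons)
  next
    case (Cons d s')
    have "set (s' @ [r']) \<subseteq> R"
      using s Cons R by auto
    then have "cf_before x m A ((s' @ [r']) @ B)"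
      using rdy unfolding ready_def by blast
    then have "cf_before x (\<not> m) (r # A) (d # (s' @ r' # B))"
      using Cons x dom ge2 s R by (intro cf_before_Cons) auto
    then show ?thesis
      using Cons by simp
  qed
next
  fix s assume s: "set s \<subseteq> R'" "s \<noteq> []"
  then obtain d s' where Cons: "s = d # s'"
    by (cases s) auto
  have "set (s' @ [r]) \<subseteq> R"
    using s Cons R by auto
  then have "cf_before x m B ((s' @ [r]) @ A)"
    using rdy unfolding ready_def by blast
  then have "cf_before x (\<not> m) (r' # B) (d # (s' @ r # A))"
    using Cons x dom ge2 s R by (intro cf_before_Cons) auto
  then show "cf_before x (\<not> m) (r' # B) (s @ r # A)"
    using Cons by simp
qed

text \<open>First r is moved to the left end. Then B faces lists (s @ [r]) @ A, which the second
  part of \<open>ready\<close> covers, s @ [r] being nonempty.\<close>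

lemma place_extremal_pair:
  assumes x: "x > 0" and rdy: "ready x m A B (set w)" and w: "mset w = mset (r # r' # R)"
    and dom: "\<And>d. d \<in> set (r' # R) \<Longrightarrow> dominated m d r" "\<And>d. d \<in> set R \<Longrightarrow> dominated m d r'"
    and ge2: "\<And>d. d \<in> set w \<Longrightarrow> d \<ge> 2"
  shows "\<exists>w'. mset w' = mset R \<and>
    join_value x (r # A) (w' @ r' # B) \<le> join_value x A (w @ B)"
proof -
  have set_w: "set w = set (r # r' # R)"
    using w by (metis set_mset_mset)
  have refl: "dominated m r r" "dominated m r' r'"
    by (auto simp: dominated_def)
  obtain u where u: "mset w = mset (r # u)" "join_value x A (r # u @ B) \<le> join_value x A (w @ B)"
    using place_extremal_left[OF x, of r w m A B] rdy dom refl ge2 unfolding ready_def set_w by auto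
  have mu: "mset u = mset (r' # R)"
    using u(1) w by simp
  then have set_u: "set u = set (r' # R)"
    by (metis set_mset_mset)
  have before: "cf_before x m B (s @ r # A)" if "set s \<subseteq> set u" for s
  proof -
    have "set (s @ [r]) \<subseteq> set w" "s @ [r] \<noteq> []"
      using that set_u set_w by auto
    then have "cf_before x m B ((s @ [r]) @ A)"
      using rdy unfolding ready_def by blast
    then show ?thesis by simp
  qed
  obtain w' where w': "mset u = mset (r' # w')"
      "join_value x (r # A) (w' @ r' # B) \<le> join_value x (r # A) (u @ B)"
    using place_extremal_right[OF x, of r' u m B "r # A"] before dom refl ge2
    unfolding set_w set_u by auto
  moreover have "join_value x (r # A) (u @ B) = join_value x A (r # u @ B)"
    using join_value_shift[of x A "[r]" "u @ B"] by simp
  ultimately show ?thesis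
    using u mu by (intro exI[of _ w']) auto
qed

text \<open>On a non-increasing list the first two entries are the largest and the last two the
  smallest. The outer one of each pair goes to the left, the side that
  \<open>place_extremal_pair\<close> serves first.\<close>

function alternating :: "bool \<Rightarrow> nat list \<Rightarrow> nat list" where
  "alternating m D =
    (if length D < 2 then D
     else if m then hd D # alternating False (tl (tl D)) @ [hd (tl D)]
     else last D # alternating True (butlast (butlast D)) @ [last (butlast D)])"
  by auto
termination
  by (relation "measure (\<lambda>(m, D). length D)") auto

declare alternating.simps [simp del]

lemma alternating_short: "length D < 2 \<Longrightarrow> alternating m D = D"
  by (subst alternating.simps) simp

lemma alternating_True: "alternating True (r # r' # R) = r # alternating False R @ [r']"
  by (subst alternating.simps) simp

lemma alternating_False: "alternating False (R @ [r', r]) = r # alternating True R @ [r']"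
  by (subst alternating.simps) (simp add: butlast_append)

lemma list_snoc2_cases:
  assumes "length D \<ge> 2"
  obtains R a b where "D = R @ [a, b]"
proof -
  from assms obtain b R' where "D = R' @ [b]"
    by (cases D rule: rev_cases) auto
  moreover with assms obtain a R where "R' = R @ [a]"
    by (cases R' rule: rev_cases) auto
  ultimately show thesis
    using that by auto
qed

lemma mset_alternating: "mset (alternating m D) = mset D"
proof (induction "length D" arbitrary: m D rule: less_induct)
  case less
  show ?case
  proof (cases "length D < 2")
    case True
    then show ?thesis by (simp add: alternating_short)
  next
    case False
    show ?thesis
    proof (cases m)
      case True
      obtain r r' R where "D = r # r' # R"
        using False by (cases D; cases "tl D") auto
      with less True show ?thesis by (simp add: alternating_True)
    next
      case m: False
      obtain r r' R where "D = R @ [r', r]"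
        using False list_snoc2_cases by (metis not_le)
      with less m show ?thesis by (simp add: alternating_False)
    qed
  qed
qed

lemma length_alternating: "length (alternating m D) = length D"
  using mset_alternating by (rule mset_eq_length)

lemma set_alternating: "set (alternating m D) = set D"
  using mset_alternating by (rule mset_eq_setD)

text \<open>Induction on the number of unplaced degrees: \<open>place_extremal_pair\<close> brings r
  and r' to the ends of \<open>w\<close>, they are absorbed into A and B, and
  \<open>ready_step\<close> restores the invariant with the flag flipped.\<close>

lemma alternating_minimal:
  assumes "x > 0" "ready x m A B (set D)" "sorted_wrt (\<ge>) D" "mset w = mset D"
    and "\<And>d. d \<in> set A \<union> set B \<union> set D \<Longrightarrow> d \<ge> 2"
  shows "join_value x A (alternating m D @ B) \<le> join_value x A (w @ B)"
  using assms(2-)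
proof (induction "length D" arbitrary: m A B D w rule: less_induct)
  case less
  note x = \<open>x > 0\<close>
  have set_w: "set w = set D"
    using less.prems(3) by (metis set_mset_mset)
  show ?case
  proof (cases "length D < 2")
    case True
    then have "w = D"
      using less.prems(3) by (cases D; cases "tl D") auto
    with True show ?thesis by (simp add: alternating_short)
  next
    case False
    \<comment> \<open>Treats both flags at once: r and r' are the first two entries of D, or the
      last and the second last.\<close>
    obtain r r' R where D: "mset D = mset (r # r' # R)" "length R < length D"
        "sorted_wrt (\<ge>) R"
        "alternating m D = r # alternating (\<not> m) R @ [r']"
      and dom: "\<And>d. d \<in> set (r' # R) \<Longrightarrow> dominated m d r" "\<And>d. d \<in> set R \<Longrightarrow> dominated m d r'"
    proof (cases m)
      case True
      obtain r r' R where "D = r # r' # R"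
        using False by (cases D; cases "tl D") auto
      with less.prems(2) True that[of r r' R] show thesis
        by (auto simp: alternating_True dominated_def)
    next
      case m: False
      obtain r r' R where "D = R @ [r', r]"
        using False list_snoc2_cases by (metis not_le)
      with less.prems(2) m that[of r r' R] show thesis
        by (auto simp: alternating_False dominated_def sorted_wrt_append)
    qed
    have set_D: "set D = set (r # r' # R)"
      using D(1) by (metis set_mset_mset)
    obtain w' where w': "mset w' = mset R"
        "join_value x (r # A) (w' @ r' # B) \<le> join_value x A (w @ B)"
      using place_extremal_pair[OF x, of m A B w r r' R] less.prems D dom set_w by auto
    have "ready x (\<not> m) (r # A) (r' # B) (set R)"
      using ready_step[OF x less.prems(1), of r r' "set R"] dom less.prems set_D by auto
    then have "join_value x (r # A) (alternating (\<not> m) R @ r' # B) \<le> join_value x (r # A) (w' @ r' # B)"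
      using less.hyps[of R "\<not> m" "r # A" "r' # B" w'] D w' less.prems(4) set_D by auto
    moreover have "join_value x A (alternating m D @ B) =
        join_value x (r # A) (alternating (\<not> m) R @ r' # B)"
      using join_value_shift[of x A "[r]" "alternating (\<not> m) R @ r' # B"] D by simp
    ultimately show ?thesis
      using w' by linarith
  qed
qed

text \<open>Both sides start with the least quotient, which is why the largest degrees are placed
  first.\<close>

lemma ready_Nil:
  assumes "x > 0" "\<And>d. d \<in> R \<Longrightarrow> d \<ge> 2"
  shows "ready x True [] [] R"
  using assms by (auto simp: ready_def cf_before_def intro!: cf_le_Nil)

text \<open>Removing two entries at each end lowers the midpoint by 2, preserves both parities, and
  shifts the direct index j as well as the mirrored index n + 2 - j by 2.\<close>

lemma spine_degree_step:
  assumes j: "3 \<le> j" "j \<le> length R + 2"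
  shows "spine_degree (a # b # R @ [c, d]) j = spine_degree R (j - 2)"
proof -
  let ?D = "a # b # R @ [c, d]" and ?l = "length R"
  have idx: "?D ! (k - 1) = R ! (k - 2 - 1)" if "3 \<le> k" "k \<le> ?l + 2" for k
    using that by (auto simp: nth_append nth_Cons' numeral_3_eq_3)
  have k: "(length ?D + 1) div 2 = (?l + 1) div 2 + 2"
    by simp
  have le: "j \<le> (length ?D + 1) div 2 \<longleftrightarrow> j - 2 \<le> (?l + 1) div 2"
    using j by (simp add: k le_diff_conv)
  have par: "odd j \<longleftrightarrow> odd (j - 2)" "odd (length ?D + 1 - j) \<longleftrightarrow> odd (?l + 1 - (j - 2))"
    using j by auto
  have shift: "length ?D + 2 - j - 1 = ?l + 6 - j - 1" "?l + 2 - (j - 2) - 1 = ?l + 6 - j - 2 - 1"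
    using j by auto
  \<comment> \<open>The mirrored index is in the range of \<open>idx\<close> only for j \<ge> 4. At
    j = 3, the first position of R, the direct index is used.\<close>
  show ?thesis
  proof (cases "odd (j - 2) \<and> j - 2 \<le> (?l + 1) div 2")
    case True
    then have "odd (j - 2)" "j - 2 \<le> (?l + 1) div 2"
      by auto
    then show ?thesis
      unfolding spine_degree_def Let_def le par idx[OF j] by (simp only: if_True not_False_eq_True)
  next
    case False
    then have "j \<noteq> 3"
      using j by auto
    then have "?D ! (length ?D + 2 - j - 1) = R ! (?l + 2 - (j - 2) - 1)"
      unfolding shift using j by (intro idx) auto
    then show ?thesis
      unfolding spine_degree_def Let_def le par idx[OF j] by (simp only:)
  qed
qed

text \<open>A round of largest and a round of smallest degrees fill two positions at each end, so
  the induction descends by four.\<close>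

lemma spine_degree_alternating:
  "map (spine_degree D) [1..<length D + 1] = alternating True D"
proof (induction "length D" arbitrary: D rule: less_induct)
  case less
  show ?case
  proof (cases "length D < 4")
    case True
    then consider "D = []" | a where "D = [a]" | a b where "D = [a, b]" | a b c where "D = [a, b, c]"
      by (auto simp: numeral_eq_Suc less_Suc_eq length_Suc_conv)
    then show ?thesis
      by cases (auto simp: alternating_True alternating_short spine_degree_def)
  next
    case False
    obtain a b D' where "D = a # b # D'"
      using False by (cases D; cases "tl D") auto
    moreover obtain R c d where "D' = R @ [c, d]"
      using False \<open>D = a # b # D'\<close> by (elim list_snoc2_cases[of D', rotated]) auto
    ultimately have D: "D = a # b # R @ [c, d]"
      by simp
    have alt: "alternating True D = a # d # alternating True R @ [c, b]"
      by (simp add: D alternating_True alternating_False)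
    have *: "map (spine_degree D) [3..<length R + 3] = map (spine_degree R) [1..<length R + 1]"
      by (rule nth_equalityI) (auto simp: D spine_degree_step simp del: upt_Suc)
    have "[1..<length R + 5] = [1, 2] @ [3..<length R + 5]"
      by (simp add: upt_conv_Cons numeral_eq_Suc del: upt_Suc)
    moreover have "[3..<length R + 5] = [3..<length R + 3] @ [length R + 3, length R + 4]"
      by (simp add: numeral_eq_Suc)
    moreover have "length D + 1 = length R + 5"
      by (simp add: D)
    ultimately have "[1..<length D + 1] = [1, 2] @ [3..<length R + 3] @ [length R + 3, length R + 4]"
      by (simp only:)
    then have "map (spine_degree D) [1..<length D + 1] = [spine_degree D 1, spine_degree D 2] @
        alternating True R @ [spine_degree D (length R + 3), spine_degree D (length R + 4)]"
      using * less[of R] D by (simp only: map_append list.map) simp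
    moreover have "spine_degree D 1 = a" "spine_degree D 2 = d"
      by (simp_all add: D spine_degree_def nth_append)
    \<comment> \<open>Counted from the right end, position n - 1 is even and takes its own entry,
      whereas position n is odd and takes the second entry.\<close>
    moreover have "spine_degree D (length R + 3) = c"
    proof -
      have "\<not> length R + 3 \<le> (length D + 1) div 2" "length D + 1 - (length R + 3) = 2"
        "D ! (length R + 3 - 1) = c"
        by (auto simp: D nth_append)
      then show ?thesis
        by (simp add: spine_degree_def Let_def)
    qed
    moreover have "spine_degree D (length R + 4) = b"
    proof -
      have "\<not> length R + 4 \<le> (length D + 1) div 2" "length D + 1 - (length R + 4) = 1"
        "D ! (length D + 2 - (length R + 4) - 1) = b"
        by (auto simp: D)
      then show ?thesis
        by (simp add: spine_degree_def Let_def)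
    qed
    ultimately show ?thesis
      by (simp add: alt)
  qed
qed

section \<open>Matching polynomials of caterpillars\<close>

text \<open>The matching polynomial of a bare edge set, so that deleting vertices becomes filtering
  edges.\<close>

definition matching_sum :: "real \<Rightarrow> 'a set set \<Rightarrow> real" where
  "matching_sum x E = (\<Sum>F | F \<subseteq> E \<and> pairwise disjnt F. x ^ card F)"

lemma matching_poly_eq_matching_sum:
  assumes "finite (edges G)"
  shows "matching_poly G x = matching_sum x (edges G)"
proof -
  let ?S = "{F. F \<subseteq> edges G \<and> pairwise disjnt F}"
  have fin: "finite ?S"
    using assms by simp
  have "matching_sum x (edges G) =
      (\<Sum>k\<le>card (edges G). \<Sum>F | F \<in> ?S \<and> card F = k. x ^ card F)"
    unfolding matching_sum_def using fin assms
    by (intro sum.group[symmetric]) (auto intro: card_mono)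
  also have "\<dots> = (\<Sum>k\<le>card (edges G). real (num_matchings G k) * x ^ k)"
    by (intro sum.cong) (auto simp: num_matchings_def matching_def)
  finally show ?thesis
    by (simp add: matching_poly_def)
qed

lemma matching_sum_empty [simp]: "matching_sum x {} = 1"
proof -
  have "{F. F \<subseteq> {} \<and> pairwise disjnt F} = {{} :: 'a set set}"
    by auto
  then show ?thesis
    by (simp add: matching_sum_def)
qed

text \<open>A matching either avoids v or has exactly one edge e at v, and its other edges are then
  disjoint from e.\<close>

lemma matching_sum_vertex:
  assumes "finite E"
  shows "matching_sum x E = matching_sum x {e \<in> E. v \<notin> e} +
    x * (\<Sum>e | e \<in> E \<and> v \<in> e. matching_sum x {f \<in> E. disjnt e f})"
proof -
  let ?M = "\<lambda>E. {F. F \<subseteq> E \<and> pairwise disjnt F}"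
  let ?V = "{e \<in> E. v \<in> e}" and ?N = "\<lambda>e. {f \<in> E. disjnt e f}"
  have fin: "finite (?M E')" if "E' \<subseteq> E" for E'
    by (rule finite_subset[of _ "Pow E"]) (use that assms in auto)
  have notin: "e \<notin> F" if "F \<subseteq> ?N e" "v \<in> e" for e F
    using that by (auto simp: disjnt_def)
  have split: "?M E = ?M {e \<in> E. v \<notin> e} \<union> (\<Union>e\<in>?V. insert e ` ?M (?N e))"
  proof (intro equalityI subsetI)
    fix F assume F: "F \<in> ?M E"
    show "F \<in> ?M {e \<in> E. v \<notin> e} \<union> (\<Union>e\<in>?V. insert e ` ?M (?N e))"
    proof (cases "\<exists>e\<in>F. v \<in> e")
      case True
      then obtain e where e: "e \<in> F" "v \<in> e"
        by auto
      have "F - {e} \<in> ?M (?N e)" "F = insert e (F - {e})"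
        using F e by (auto simp: pairwise_def)
      then have "F \<in> insert e ` ?M (?N e)"
        by (metis imageI)
      then show ?thesis
        using e F by auto
    qed (use F in auto)
  next
    fix F assume "F \<in> ?M {e \<in> E. v \<notin> e} \<union> (\<Union>e\<in>?V. insert e ` ?M (?N e))"
    then consider "F \<in> ?M {e \<in> E. v \<notin> e}" | e F' where "e \<in> ?V" "F' \<in> ?M (?N e)" "F = insert e F'"
      by blast
    then show "F \<in> ?M E"
    proof cases
      case (2 e F')
      then have "\<forall>f\<in>F'. disjnt e f \<and> disjnt f e"
        by (auto simp: disjnt_sym)
      then show ?thesis
        using 2 by (auto simp: pairwise_insert)
    qed auto
  qed
  have inter: "insert e ` ?M (?N e) \<inter> insert e' ` ?M (?N e') = {}"
    if "e \<in> ?V" "e' \<in> ?V" "e \<noteq> e'" for e e'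
    using that by (auto simp: disjnt_def)
  have "(\<Sum>F\<in>insert e ` ?M (?N e). x ^ card F) = x * matching_sum x (?N e)" if e: "e \<in> ?V" for e
  proof -
    have inj: "inj_on (insert e) (?M (?N e))"
      using notin e by (intro inj_onI) (metis (no_types, lifting) insert_ident mem_Collect_eq)
    have "(\<Sum>F\<in>insert e ` ?M (?N e). x ^ card F) = (\<Sum>F\<in>?M (?N e). x ^ card (insert e F))"
      by (simp add: sum.reindex[OF inj])
    also have "\<dots> = (\<Sum>F\<in>?M (?N e). x * x ^ card F)"
    proof (rule sum.cong)
      fix F assume F: "F \<in> ?M (?N e)"
      then have "finite F" "e \<notin> F"
        using notin[of F e] e assms by (auto intro: finite_subset)
      then show "x ^ card (insert e F) = x * x ^ card F"
        by simp
    qed simp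
    finally show ?thesis
      by (simp add: matching_sum_def sum_distrib_left)
  qed
  then have "(\<Sum>F\<in>(\<Union>e\<in>?V. insert e ` ?M (?N e)). x ^ card F) =
      x * (\<Sum>e\<in>?V. matching_sum x (?N e))"
    using assms inter fin by (subst sum.UNION_disjoint) (auto simp: sum_distrib_left)
  moreover have "matching_sum x E = (\<Sum>F\<in>?M {e \<in> E. v \<notin> e}. x ^ card F) +
      (\<Sum>F\<in>(\<Union>e\<in>?V. insert e ` ?M (?N e)). x ^ card F)"
    unfolding matching_sum_def split using assms fin
    by (intro sum.union_disjoint) auto
  ultimately show ?thesis
    by (simp add: matching_sum_def)
qed

section \<open>Edge sets and matchings along a spine\<close>

definition path_edges :: "'a list \<Rightarrow> 'a set set" where
  "path_edges p = {{p ! i, p ! Suc i} | i. Suc i < length p}"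

lemma path_edges_simps [simp]:
  "path_edges [] = {}" "path_edges [v] = {}"
  "path_edges (v # w # t) = insert {v, w} (path_edges (w # t))"
proof -
  show "path_edges (v # w # t) = insert {v, w} (path_edges (w # t))"
  proof (intro equalityI subsetI)
    fix e assume "e \<in> path_edges (v # w # t)"
    then obtain i where "e = {(v # w # t) ! i, (v # w # t) ! Suc i}" "Suc i < length (v # w # t)"
      unfolding path_edges_def by blast
    then show "e \<in> insert {v, w} (path_edges (w # t))"
      by (cases i) (auto simp: path_edges_def)
  next
    fix e assume "e \<in> insert {v, w} (path_edges (w # t))"
    then consider "e = {v, w}" | i where "e = {(w # t) ! i, (w # t) ! Suc i}" "Suc i < length (w # t)"
      unfolding path_edges_def by blast
    then show "e \<in> path_edges (v # w # t)"
    proof cases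
      case 1
      then show ?thesis
        unfolding path_edges_def by (intro CollectI exI[of _ 0]) simp
    next
      case (2 i)
      then show ?thesis
        unfolding path_edges_def by (intro CollectI exI[of _ "Suc i"]) simp
    qed
  qed
qed (auto simp: path_edges_def)

lemma path_edges_subset: "e \<in> path_edges p \<Longrightarrow> e \<subseteq> set p"
  by (auto simp: path_edges_def)

lemma finite_path_edges: "finite (path_edges p)"
  by (induction p rule: induct_list012) auto

lemma path_edges_avoid_hd:
  assumes "distinct (v # t)"
  shows "{e \<in> path_edges (v # t). v \<notin> e} = path_edges t"
  using assms path_edges_subset[of _ t] by (cases t) auto

text \<open>The second conjunct makes the outer ends leaves: no two edges of L share one.\<close>

definition pendant_edges :: "'a set \<Rightarrow> 'a set set \<Rightarrow> bool" where
  "pendant_edges P L \<longleftrightarrow> (\<forall>e\<in>L. \<exists>v\<in>P. \<exists>l. l \<notin> P \<and> e = {v, l}) \<and>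
     (\<forall>e\<in>L. \<forall>e'\<in>L. e \<noteq> e' \<longrightarrow> e \<inter> e' \<subseteq> P)"

lemma pendant_edgesE:
  assumes "pendant_edges P L" "e \<in> L"
  obtains v l where "v \<in> P" "l \<notin> P" "e = {v, l}"
  using assms by (auto simp: pendant_edges_def)

text \<open>
  \<open>L\<close> is kept fixed while \<open>p\<close> runs through the suffixes of the spine, so the pendant edges not
  meeting \<open>p\<close> have to be filtered out.
\<close>

definition caterpillar_edges :: "'a list \<Rightarrow> 'a set set \<Rightarrow> 'a set set" where
  "caterpillar_edges p L = path_edges p \<union> {e \<in> L. e \<inter> set p \<noteq> {}}"

lemma caterpillar_edges_Nil [simp]: "caterpillar_edges [] L = {}"
  by (simp add: caterpillar_edges_def)

lemma caterpillar_edges_avoid_hd: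
  assumes "pendant_edges P L" "distinct (v # t)" "set (v # t) \<subseteq> P"
  shows "{e \<in> caterpillar_edges (v # t) L. v \<notin> e} = caterpillar_edges t L"
proof -
  have "v \<notin> e" if "e \<in> L" "e \<inter> set t \<noteq> {}" for e
  proof -
    obtain u l where "e = {u, l}" "l \<notin> P"
      using pendant_edgesE[OF assms(1) \<open>e \<in> L\<close>] by metis
    then show ?thesis
      using that(2) assms by auto
  qed
  then have "{e \<in> {e \<in> L. e \<inter> set (v # t) \<noteq> {}}. v \<notin> e} = {e \<in> L. e \<inter> set t \<noteq> {}}"
    by auto
  moreover have "{e \<in> A \<union> B. v \<notin> e} = {e \<in> A. v \<notin> e} \<union> {e \<in> B. v \<notin> e}" for A B
    by auto
  ultimately show ?thesis
    unfolding caterpillar_edges_def using path_edges_avoid_hd[OF assms(2)] by (simp only:)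
qed

text \<open>The outer end of e lies on no other edge, so disjointness from e only means avoiding
  v.\<close>

lemma caterpillar_edges_disjoint_pendant:
  assumes "pendant_edges P L" "distinct (v # t)" "set (v # t) \<subseteq> P" "e \<in> L" "v \<in> e"
  shows "{f \<in> caterpillar_edges (v # t) L. disjnt e f} = caterpillar_edges t L"
proof -
  obtain l where l: "e = {v, l}" "l \<notin> P"
    using pendant_edgesE[OF assms(1,4)] assms(3,5)
    by (metis insertE insert_commute list.set_intros(1) singletonD subsetD)
  have "l \<notin> f" if "f \<in> caterpillar_edges t L" "v \<notin> f" for f
  proof (cases "f \<in> L")
    case True
    then have "e \<inter> f \<subseteq> P"
      using assms that unfolding pendant_edges_def by metis
    then show ?thesis
      using l by auto
  next
    case False
    then have "f \<subseteq> P"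
      using that assms path_edges_subset[of f t] by (auto simp: caterpillar_edges_def)
    then show ?thesis
      using l by auto
  qed
  then have "{f \<in> caterpillar_edges (v # t) L. disjnt e f} =
      {f \<in> caterpillar_edges (v # t) L. v \<notin> f}"
    using caterpillar_edges_avoid_hd[OF assms(1-3)] l by (auto simp: disjnt_def)
  then show ?thesis
    using caterpillar_edges_avoid_hd[OF assms(1-3)] by simp
qed

text \<open>Expansion at the first spine vertex: leaving it free or using one of its pendant edges
  leaves the rest of the spine, which gives the factor \<open>a x v\<close>; using the spine edge
  also removes the next vertex.\<close>

lemma matching_sum_caterpillar:
  fixes L :: "'a set set"
  defines "a \<equiv> \<lambda>x v. 1 + x * real (card {e \<in> L. v \<in> e})"
  assumes "finite L" "pendant_edges P L" "distinct p" "set p \<subseteq> P"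
  shows "matching_sum x (caterpillar_edges p L) = fst (transfer x (map (a x) p) (1, 0))"
  using assms(4,5)
proof (induction p rule: induct_list012)
  case 1
  then show ?case by (simp add: caterpillar_edges_def)
next
  case (2 v)
  let ?E = "caterpillar_edges [v] L"
  have "{e \<in> ?E. v \<in> e} = {e \<in> L. v \<in> e}"
    by (auto simp: caterpillar_edges_def)
  moreover have "matching_sum x {f \<in> ?E. disjnt e f} = 1" if "e \<in> L" "v \<in> e" for e
    using caterpillar_edges_disjoint_pendant[OF assms(3) 2 that]
    by (simp only: caterpillar_edges_Nil matching_sum_empty)
  moreover have "matching_sum x {e \<in> ?E. v \<notin> e} = 1"
    using caterpillar_edges_avoid_hd[OF assms(3) 2]
    by (simp only: caterpillar_edges_Nil matching_sum_empty)
  moreover have "finite ?E"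
    using assms(2) by (simp add: caterpillar_edges_def)
  ultimately show ?case
    using matching_sum_vertex[of ?E x v] by (simp add: a_def)
next
  case (3 v w t)
  let ?E = "caterpillar_edges (v # w # t) L" and ?E' = "caterpillar_edges (w # t) L"
  note avoid_v = caterpillar_edges_avoid_hd[OF assms(3) "3.prems"]
  have avoid_w: "{e \<in> ?E'. w \<notin> e} = caterpillar_edges t L"
    using caterpillar_edges_avoid_hd[OF assms(3), of w t] "3.prems" by simp
  have notL: "{v, w} \<notin> L"
  proof
    assume "{v, w} \<in> L"
    then obtain u l where "{v, w} = {u, l}" "l \<notin> P"
      using pendant_edgesE[OF assms(3)] by metis
    then show False
      using "3.prems" by (auto simp: doubleton_eq_iff)
  qed
  have at_v: "{e \<in> ?E. v \<in> e} = insert {v, w} {e \<in> L. v \<in> e}"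
    using "3.prems" path_edges_subset[of _ "w # t"] by (auto simp: caterpillar_edges_def)
  have "{f \<in> ?E. disjnt {v, w} f} = {f \<in> {e \<in> ?E. v \<notin> e}. w \<notin> f}"
    by (auto simp: disjnt_def)
  then have disj: "{f \<in> ?E. disjnt {v, w} f} = caterpillar_edges t L"
    using avoid_v avoid_w by simp
  define g where "g e = matching_sum x {f \<in> ?E. disjnt e f}" for e
  have "g e = matching_sum x ?E'" if "e \<in> L" "v \<in> e" for e
    using caterpillar_edges_disjoint_pendant[OF assms(3) "3.prems" that] by (simp only: g_def)
  then have "sum g {e \<in> ?E. v \<in> e} = g {v, w} + real (card {e \<in> L. v \<in> e}) * matching_sum x ?E'"
    unfolding at_v using assms(2) notL by simp
  moreover have "g {v, w} = matching_sum x (caterpillar_edges t L)"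
    by (simp only: g_def disj)
  moreover have "finite ?E"
    using assms(2) finite_path_edges by (simp add: caterpillar_edges_def)
  ultimately have "matching_sum x ?E = a x v * matching_sum x ?E' + x * matching_sum x (caterpillar_edges t L)"
    using matching_sum_vertex[of ?E x v] avoid_v by (simp add: a_def g_def algebra_simps)
  moreover have "matching_sum x ?E' = fst (transfer x (map (a x) (w # t)) (1, 0))"
    using "3.IH" "3.prems" by auto
  moreover have "matching_sum x (caterpillar_edges t L) = fst (transfer x (map (a x) t) (1, 0))"
    using "3.IH" "3.prems" by auto
  ultimately show ?case
    by simp
qed

lemma card_path_edges_at:
  assumes "distinct p" "i < length p"
  shows "card {e \<in> path_edges p. p ! i \<in> e} = of_bool (0 < i) + of_bool (Suc i < length p)"
proof -
  let ?l = "if 0 < i then {{p ! (i - 1), p ! i}} else {}"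
  let ?r = "if Suc i < length p then {{p ! i, p ! Suc i}} else {}"
  have "{e \<in> path_edges p. p ! i \<in> e} = ?l \<union> ?r"
  proof (intro equalityI subsetI)
    fix e assume "e \<in> {e \<in> path_edges p. p ! i \<in> e}"
    then obtain j where j: "e = {p ! j, p ! Suc j}" "Suc j < length p" "p ! i = p ! j \<or> p ! i = p ! Suc j"
      unfolding path_edges_def by auto
    then have "i = j \<or> i = Suc j"
      using assms by (auto simp: nth_eq_iff_index_eq)
    then show "e \<in> ?l \<union> ?r"
      using j by auto
  next
    fix e assume "e \<in> ?l \<union> ?r"
    then consider "0 < i" "e = {p ! (i - 1), p ! i}" | "Suc i < length p" "e = {p ! i, p ! Suc i}"
      by (auto split: if_splits)
    then show "e \<in> {e \<in> path_edges p. p ! i \<in> e}"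
    proof cases
      case 1
      then show ?thesis
        using assms unfolding path_edges_def by (intro CollectI conjI exI[of _ "i - 1"]) auto
    next
      case 2
      then show ?thesis
        unfolding path_edges_def by (intro CollectI conjI exI[of _ i]) auto
    qed
  qed
  moreover have "?l \<inter> ?r = {}"
    using assms by (auto simp: doubleton_eq_iff nth_eq_iff_index_eq)
  ultimately show ?thesis
    by (simp add: card_Un_disjoint)
qed

text \<open>An entry 1 beyond an end adds x to the end entry: on the right through the start vector
  (1, 1) instead of (1, 0), on the left through \<open>pairing\<close> with (1, 1). A single vertex
  receives both corrections.\<close>

lemma transfer_end_correction:
  assumes "ds \<noteq> []" "length cs = length ds"
    and "\<And>i. i < length ds \<Longrightarrow>
      cs ! i = weight x (ds ! i) + x * of_bool (i = 0) + x * of_bool (Suc i = length ds)"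
  shows "fst (transfer x cs (1, 0)) = join_value x [] ds"
proof (cases "length ds = 1")
  case True
  then obtain d where "ds = [d]"
    by (metis One_nat_def length_0_conv length_Suc_conv)
  moreover obtain c where "cs = [c]"
    using assms(2) True by (metis One_nat_def length_0_conv length_Suc_conv)
  ultimately show ?thesis
    using assms(3)[of 0] by (simp add: join_value_def pairing_def tail_pair_def)
next
  case False
  obtain d e m where ds: "ds = d # m @ [e]"
    using assms(1) False by (cases ds; cases "tl ds" rule: rev_cases) auto
  have "cs = (weight x d + x) # map (weight x) m @ [weight x e + x]"
  proof (rule nth_equalityI)
    fix i assume "i < length cs"
    then show "cs ! i = ((weight x d + x) # map (weight x) m @ [weight x e + x]) ! i"
      using assms(2) assms(3)[of i] ds by (auto simp: nth_Cons' nth_append)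
  qed (use assms(2) ds in simp)
  then show ?thesis
    by (simp add: ds transfer_append join_value_def pairing_def tail_pair_def algebra_simps)
qed

lemma matching_sum_eq_join_value:
  assumes "finite L" "pendant_edges (set p) L" "distinct p" "p \<noteq> []" "length ds = length p"
    and "\<And>i. i < length p \<Longrightarrow>
      ds ! i = card {e \<in> L. p ! i \<in> e} + of_bool (0 < i) + of_bool (Suc i < length p)"
  shows "matching_sum x (path_edges p \<union> L) = join_value x [] ds"
proof -
  have "{e \<in> L. e \<inter> set p \<noteq> {}} = L"
    using assms(2) unfolding pendant_edges_def by auto
  then have "matching_sum x (path_edges p \<union> L) =
      fst (transfer x (map (\<lambda>v. 1 + x * real (card {e \<in> L. v \<in> e})) p) (1, 0))"
    using matching_sum_caterpillar[OF assms(1-3) order_refl] by (simp add: caterpillar_edges_def)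
  \<comment> \<open>With s spine neighbours the entry is 1 + (d - s) x = \<open>weight x d\<close> +
    (2 - s) x, and 2 - s counts the ends of the spine at this vertex.\<close>
  also have "\<dots> = join_value x [] ds"
    using assms(4-6) by (intro transfer_end_correction) (auto simp: weight_def algebra_simps)
  finally show ?thesis .
qed

section \<open>Spine and pendant edges of a caterpillar graph\<close>

lemma leaf_edge_unique:
  assumes "v \<in> leaves G" "e \<in> edges G" "v \<in> e" "e' \<in> edges G" "v \<in> e'"
  shows "e = e'"
proof -
  have "card {e \<in> edges G. v \<in> e} = 1"
    using assms(1) by (simp add: leaves_def degree_def)
  then obtain e0 where e0: "{e \<in> edges G. v \<in> e} = {e0}"
    by (metis card_1_singletonE)
  have "e \<in> {e \<in> edges G. v \<in> e}" "e' \<in> {e \<in> edges G. v \<in> e}"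
    using assms by auto
  then show ?thesis
    unfolding e0 by simp
qed

text \<open>Two adjacent leaves would form a whole component, cut off from any non-leaf z.\<close>

lemma leaves_not_adjacent:
  assumes "connected_graph G" "{u, l} \<in> edges G" "l \<in> leaves G" "verts G \<noteq> leaves G"
  shows "u \<notin> leaves G"
proof
  assume u: "u \<in> leaves G"
  have only: "e = {u, l}" if "e \<in> edges G" "v \<in> e" "v \<in> {u, l}" for e v
    using leaf_edge_unique[of v G e "{u, l}"] that u assms(2,3) by auto
  have "leaves G \<subseteq> verts G"
    by (auto simp: leaves_def)
  then obtain z where z: "z \<in> verts G" "z \<notin> leaves G"
    using assms(4) by blast
  have "u \<in> verts G"
    using u by (simp add: leaves_def)
  then have "(u, z) \<in> (adj G)\<^sup>*"
    using assms(1) z by (simp add: connected_graph_def)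
  then have "z \<in> {u, l}"
  proof (induction rule: rtrancl_induct)
    case (step y z)
    then show ?case
      using only[of "{y, z}" y] by (auto simp: adj_def)
  qed simp
  then show False
    using u assms(3) z by auto
qed

lemma caterpillar_decomposition:
  assumes "caterpillar G" "verts G \<noteq> leaves G"
  obtains p L where "distinct p" "p \<noteq> []" "set p = verts G - leaves G" "finite L"
    "edges G = path_edges p \<union> L" "path_edges p \<inter> L = {}" "pendant_edges (set p) L"
proof -
  have G: "simple_graph G" "connected_graph G" "is_path (delete_verts G (leaves G))"
    using assms(1) by (auto simp: caterpillar_def tree_def)
  obtain p where p: "distinct p" "set p = verts G - leaves G"
      "path_edges p = {e \<in> edges G. e \<inter> leaves G = {}}"
    using G(3) unfolding is_path_def delete_verts_def path_edges_def by auto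
  define L where "L = {e \<in> edges G. e \<inter> leaves G \<noteq> {}}"
  have fin: "finite (edges G)"
    using G(1) unfolding simple_graph_def by (meson PowI finite_Pow_iff finite_subset subsetI)
  have edge: "\<exists>v\<in>set p. \<exists>l. l \<notin> set p \<and> e = {v, l}" if "e \<in> L" for e
  proof -
    obtain l where l: "l \<in> e" "l \<in> leaves G" and e: "e \<in> edges G"
      using \<open>e \<in> L\<close> unfolding L_def by blast
    have "card e = 2" "e \<subseteq> verts G"
      using e G(1) by (auto simp: simple_graph_def)
    then obtain u where "e = {u, l}"
      using l(1) by (auto simp: card_2_iff)
    then show ?thesis
      using leaves_not_adjacent[OF G(2), of u l] l e assms(2) p(2) \<open>e \<subseteq> verts G\<close> by auto
  qed
  \<comment> \<open>A vertex on two different edges is not a leaf, hence lies on the spine.\<close>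
  have "e \<inter> e' \<subseteq> set p" if "e \<in> L" "e' \<in> L" "e \<noteq> e'" for e e'
  proof
    fix v assume v: "v \<in> e \<inter> e'"
    have "e \<in> edges G" "e' \<in> edges G" "v \<in> verts G"
      using that v G(1) by (auto simp: L_def simple_graph_def)
    then show "v \<in> set p"
      using leaf_edge_unique[of v G e e'] v \<open>e \<noteq> e'\<close> p(2) by auto
  qed
  with edge have "pendant_edges (set p) L"
    by (simp add: pendant_edges_def)
  moreover have "p \<noteq> []"
    using assms(2) p(2) by (auto simp: leaves_def)
  moreover have "edges G = path_edges p \<union> L" "path_edges p \<inter> L = {}"
    using p(3) by (auto simp: L_def)
  moreover have "finite L"
    using fin by (simp add: L_def)
  ultimately show thesis
    using that p(1,2) by metis
qed

text \<open>Here \<open>w\<close> lists the degrees along the spine. The degree bound needs two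
  spine vertices: the only vertex of K_1 forms its spine and has degree 0.\<close>

lemma caterpillar_spine:
  assumes "caterpillar G" "reduced_degree_sequence G \<noteq> []"
  obtains w where "mset w = mset (reduced_degree_sequence G)"
    "matching_poly G x = join_value x [] w"
    "length w \<ge> 2 \<Longrightarrow> \<forall>d\<in>set w. d \<ge> 2"
proof -
  have "verts G \<noteq> leaves G"
    using assms(2) by (auto simp: reduced_degree_sequence_def)
  then obtain p L where p: "distinct p" "p \<noteq> []" "set p = verts G - leaves G" "finite L"
    "edges G = path_edges p \<union> L" "path_edges p \<inter> L = {}" "pendant_edges (set p) L"
    using caterpillar_decomposition[OF assms(1)] by metis
  define w where "w = map (degree G) p"
  have deg: "degree G (p ! i) =
      card {e \<in> L. p ! i \<in> e} + of_bool (0 < i) + of_bool (Suc i < length p)" if "i < length p" for i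
  proof -
    have "{e \<in> edges G. p ! i \<in> e} = {e \<in> path_edges p. p ! i \<in> e} \<union> {e \<in> L. p ! i \<in> e}"
      using p(5) by auto
    then have "degree G (p ! i) = card {e \<in> path_edges p. p ! i \<in> e} + card {e \<in> L. p ! i \<in> e}"
      unfolding degree_def using p(4,6) finite_path_edges[of p]
      by (simp, intro card_Un_disjoint) auto
    then show ?thesis
      using card_path_edges_at[OF p(1) that] by simp
  qed
  have "mset w = mset (reduced_degree_sequence G)"
    unfolding w_def reduced_degree_sequence_def p(3)[symmetric]
    using p(1) by (simp add: mset_set_set)
  moreover have "matching_poly G x = join_value x [] w"
    using matching_sum_eq_join_value[OF p(4,7,1,2), of w x] deg
    by (simp add: w_def matching_poly_eq_matching_sum p(4,5) finite_path_edges)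
  moreover have "\<forall>d\<in>set w. d \<ge> 2" if "length w \<ge> 2"
  proof
    fix d assume "d \<in> set w"
    then obtain i where i: "i < length p" "d = degree G (p ! i)"
      by (auto simp: w_def in_set_conv_nth)
    then have "d \<noteq> 1"
      using p(3) nth_mem[OF i(1)] by (auto simp: leaves_def)
    moreover have "d \<ge> 1"
      using deg[OF i(1)] i that by (auto simp: w_def)
    ultimately show "d \<ge> 2"
      by linarith
  qed
  ultimately show thesis
    using that by blast
qed

lemma matching_poly_S_caterpillar:
  assumes "D \<noteq> []" "length D \<ge> 2 \<Longrightarrow> \<forall>d\<in>set D. d \<ge> 2"
  shows "matching_poly (S_caterpillar D) x = join_value x [] (alternating True D)"
proof -
  let ?n = "length D"
  define p where "p = map Spine [1..<?n + 1]"
  define L where "L = {{Spine j, Pendant j i} | j i. j \<in> {1..?n} \<and> i \<in> {1..num_pendants D j}}"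
  have len: "length p = ?n" and nth: "\<And>i. i < ?n \<Longrightarrow> p ! i = Spine (Suc i)"
    by (auto simp: p_def simp del: upt_Suc)
  have path: "path_edges p = {{Spine j, Spine (j + 1)} | j. 1 \<le> j \<and> j + 1 \<le> ?n}"
  proof (intro equalityI subsetI)
    fix e assume "e \<in> path_edges p"
    then obtain i where "e = {p ! i, p ! Suc i}" "Suc i < ?n"
      using len by (auto simp: path_edges_def)
    then show "e \<in> {{Spine j, Spine (j + 1)} | j. 1 \<le> j \<and> j + 1 \<le> ?n}"
      by (intro CollectI exI[of _ "Suc i"]) (simp add: nth)
  next
    fix e assume "e \<in> {{Spine j, Spine (j + 1)} | j. 1 \<le> j \<and> j + 1 \<le> ?n}"
    then obtain j where "e = {Spine j, Spine (j + 1)}" "1 \<le> j" "j + 1 \<le> ?n"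
      by blast
    then show "e \<in> path_edges p"
      unfolding path_edges_def by (intro CollectI exI[of _ "j - 1"]) (simp add: nth len)
  qed
  have set_p: "set p = Spine ` {1..?n}"
    by (auto simp: p_def simp del: upt_Suc)
  have "L = (\<Union>j\<in>{1..?n}. \<Union>i\<in>{1..num_pendants D j}. {{Spine j, Pendant j i}})"
    unfolding L_def by blast
  then have finL: "finite L"
    by simp
  have "\<exists>v\<in>set p. \<exists>l. l \<notin> set p \<and> e = {v, l}" if "e \<in> L" for e
  proof -
    obtain j i where "e = {Spine j, Pendant j i}" "j \<in> {1..?n}"
      using \<open>e \<in> L\<close> unfolding L_def by blast
    then show ?thesis
      by (intro bexI[of _ "Spine j"] exI[of _ "Pendant j i"]) (auto simp: set_p)
  qed
  moreover have "e \<inter> e' \<subseteq> set p" if "e \<in> L" "e' \<in> L" "e \<noteq> e'" for e e'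
  proof -
    obtain j i where "e = {Spine j, Pendant j i}" "j \<in> {1..?n}"
      using \<open>e \<in> L\<close> unfolding L_def by blast
    moreover obtain j' i' where "e' = {Spine j', Pendant j' i'}"
      using \<open>e' \<in> L\<close> unfolding L_def by blast
    ultimately show ?thesis
      using \<open>e \<noteq> e'\<close> by (auto simp: set_p)
  qed
  ultimately have pend: "pendant_edges (set p) L"
    by (simp add: pendant_edges_def)
  have deg: "alternating True D ! i =
      card {e \<in> L. p ! i \<in> e} + of_bool (0 < i) + of_bool (Suc i < length p)" if i: "i < length p" for i
  proof -
    have "{e \<in> L. p ! i \<in> e} = (\<lambda>k. {Spine (Suc i), Pendant (Suc i) k}) ` {1..num_pendants D (Suc i)}"
    proof (intro equalityI subsetI)
      fix e assume "e \<in> {e \<in> L. p ! i \<in> e}"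
      then obtain j k where "e = {Spine j, Pendant j k}" "k \<in> {1..num_pendants D j}" "p ! i \<in> e"
        unfolding L_def by blast
      then show "e \<in> (\<lambda>k. {Spine (Suc i), Pendant (Suc i) k}) ` {1..num_pendants D (Suc i)}"
        using i len by (auto simp: nth)
    next
      fix e assume "e \<in> (\<lambda>k. {Spine (Suc i), Pendant (Suc i) k}) ` {1..num_pendants D (Suc i)}"
      moreover have "Suc i \<in> {1..?n}"
        using i len by simp
      ultimately have "e \<in> L" "Spine (Suc i) \<in> e"
        unfolding L_def by blast+
      then show "e \<in> {e \<in> L. p ! i \<in> e}"
        using i len by (simp add: nth)
    qed
    moreover have "inj_on (\<lambda>k. {Spine (Suc i), Pendant (Suc i) k}) {1..num_pendants D (Suc i)}"
      by (auto simp: inj_on_def doubleton_eq_iff)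
    ultimately have card: "card {e \<in> L. p ! i \<in> e} = num_pendants D (Suc i)"
      by (simp add: card_image)
    have alt: "alternating True D ! i = spine_degree D (Suc i)"
      using i len by (simp flip: spine_degree_alternating del: upt_Suc)
    have "alternating True D ! i \<in> set D"
      using i len nth_mem[of i "alternating True D"] by (simp add: length_alternating set_alternating)
    \<comment> \<open>Makes the truncated subtractions in \<open>num_pendants\<close> exact.\<close>
    then have "spine_degree D (Suc i) \<ge> 2" if "?n \<ge> 2"
      using assms(2) that alt by auto
    moreover have "?n = 1 \<or> ?n \<ge> 2"
      using assms(1) by (cases D; cases "tl D") auto
    ultimately show ?thesis
      using i len by (auto simp: card alt num_pendants_def)
  qed
  have "edges (S_caterpillar D) = path_edges p \<union> L"
    by (simp add: S_caterpillar_def Let_def path L_def)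
  then have "matching_poly (S_caterpillar D) x = matching_sum x (path_edges p \<union> L)"
    using matching_poly_eq_matching_sum[of "S_caterpillar D" x] finL finite_path_edges[of p] by simp
  also have "\<dots> = join_value x [] (alternating True D)"
  proof (rule matching_sum_eq_join_value[OF finL pend])
    show "distinct p"
      by (simp add: p_def distinct_map inj_on_def del: upt_Suc)
    show "p \<noteq> []"
      using assms(1) len by auto
    show "length (alternating True D) = length p"
      using len by (simp add: length_alternating)
  qed (rule deg)
  finally show ?thesis .
qed

theorem theorem2:
  fixes D :: "nat list" and G :: "'b graph" and H :: "'a graph" and x :: real
  assumes "length D \<ge> 1"
    and "caterpillar G" and "reduced_degree_sequence G = D"
    and "x > 0"
    and "H \<in> caterpillars_with D"
  shows "matching_poly (S_caterpillar D) x \<le> matching_poly H x"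
proof -
  have H: "caterpillar H" "reduced_degree_sequence H = D" and "D \<noteq> []"
    using assms(1,5) by (auto simp: caterpillars_with_def)
  then obtain w where w: "mset w = mset D" "matching_poly H x = join_value x [] w"
      "length w \<ge> 2 \<Longrightarrow> \<forall>d\<in>set w. d \<ge> 2"
    using caterpillar_spine by metis
  have len: "length w = length D" and set: "set w = set D"
    using w(1) by (metis size_mset, metis set_mset_mset)
  have sorted: "sorted_wrt (\<ge>) D"
    unfolding H(2)[symmetric] reduced_degree_sequence_def
    by (simp add: sorted_wrt_rev)
  have S: "matching_poly (S_caterpillar D) x = join_value x [] (alternating True D)"
    using matching_poly_S_caterpillar[OF \<open>D \<noteq> []\<close>] w(3) len set by simp
  show ?thesis
  proof (cases "length D < 2")
    \<comment> \<open>A single spine vertex leaves nothing to rearrange; its degree may be 0,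
      outside the scope of \<open>alternating_minimal\<close>.\<close>
    case True
    then have "w = D"
      using w(1) by (cases D; cases "tl D") auto
    with True show ?thesis
      using S w(2) by (simp add: alternating_short)
  next
    case False
    then have "\<forall>d\<in>set D. d \<ge> 2"
      using w(3) len set by simp
    then show ?thesis
      using alternating_minimal[OF \<open>x > 0\<close> ready_Nil[OF \<open>x > 0\<close>] sorted w(1)] S w(2) by simp
  qed
qed

end
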